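(* Let $(X,\tau)$ be a $T_4$ space, and let $\sigma$ be the topology on $X$ having $\{Z(f): f\in B_1(X,\tau)\}$ as a base for closed sets. Then $\sigma=\tau$ if and only if $B_1(X,\tau)=C(X,\tau)$.
   Context: A $T_4$ space is a normal $T_1$ space. $C(X,\tau)$ is the ring of $\tau$-continuous functions $X\to\mathbb{R}$, and $B_1(X,\tau)$ is the ring of Baire one functions on $(X,\tau)$, i.e. pointwise limits of sequences in $C(X,\tau)$. $Z(f)=\{x\in X: f(x)=0\}$. *)

theory Defs
  imports "HOL-Analysis.Analysis"
begin

text \<open>
  The carrier of a topology is its \<^const>\<open>topspace\<close>.  A function on the carrier is represented by
  a total function on the type.  Membership in the two function sets below depends only on the values
  on the carrier, so equality of these sets is equality of the corresponding sets of functions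
  on the carrier.
\<close>

definition t4_space :: "'a topology \<Rightarrow> bool" where
  "t4_space X \<longleftrightarrow> normal_space X \<and> t1_space X"

definition real_continuous_functions :: "'a topology \<Rightarrow> ('a \<Rightarrow> real) set" where
  "real_continuous_functions X = {f. continuous_map X euclideanreal f}"

definition baire_one_functions :: "'a topology \<Rightarrow> ('a \<Rightarrow> real) set" where
  "baire_one_functions X =
     {f. \<exists>g :: nat \<Rightarrow> 'a \<Rightarrow> real. (\<forall>n. g n \<in> real_continuous_functions X) \<and>
           (\<forall>x\<in>topspace X. (\<lambda>n. g n x) \<longlonglongrightarrow> f x)}"

definition zero_set :: "'a topology \<Rightarrow> ('a \<Rightarrow> real) \<Rightarrow> 'a set" where
  "zero_set X f = {x \<in> topspace X. f x = 0}"

text \<open>The intersection of the empty subfamily is read as the whole carrier.\<close>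

definition closed_base_of :: "'a set set \<Rightarrow> 'a topology \<Rightarrow> bool" where
  "closed_base_of \<B> X \<longleftrightarrow>
     (\<forall>S\<in>\<B>. closedin X S) \<and>
     (\<forall>S. closedin X S \<longrightarrow> (\<exists>\<F>\<subseteq>\<B>. S = topspace X \<inter> \<Inter>\<F>))"

definition baire_one_topology :: "'a topology \<Rightarrow> 'a topology" where
  "baire_one_topology X =
     (THE Y. topspace Y = topspace X \<and>
             closed_base_of {zero_set X f | f. f \<in> baire_one_functions X} Y)"

text \<open>The definite description is justified: such a topology exists and is unique.\<close>

lemma closed_base_of_unique:
  assumes "topspace Y = topspace Z" "closed_base_of \<B> Y" "closed_base_of \<B> Z"
  shows "Y = Z"
proof -
  have closed: "closedin Z S"
    if eq: "topspace Y = topspace Z" and "closed_base_of \<B> Y" "closed_base_of \<B> Z" "closedin Y S"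
    for Y Z :: "'a topology" and S
  proof -
    have "\<exists>\<F>\<subseteq>\<B>. S = topspace Y \<inter> \<Inter>\<F>"
      using that(2,4) unfolding closed_base_of_def by simp
    then obtain \<F> where F: "\<F> \<subseteq> \<B>" "S = topspace Z \<inter> \<Inter>\<F>"
      using eq by auto
    have "closedin Z (\<Inter>(insert (topspace Z) \<F>))"
      using F(1) that(3) by (intro closedin_Inter) (auto simp: closed_base_of_def)
    then show ?thesis using F(2) by simp
  qed
  have "closedin Y S \<longleftrightarrow> closedin Z S" for S
    using closed[OF assms] closed[OF assms(1)[symmetric] assms(3,2)] by blast
  then show ?thesis
    by (simp add: topology_eq openin_closedin_eq assms(1))
qed

lemma closed_base_of_exists:
  assumes sub: "\<And>S. S \<in> \<B> \<Longrightarrow> S \<subseteq> A" and empty: "{} \<in> \<B>"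
    and un: "\<And>S T. S \<in> \<B> \<Longrightarrow> T \<in> \<B> \<Longrightarrow> S \<union> T \<in> \<B>"
  shows "\<exists>Y. topspace Y = A \<and> closed_base_of \<B> Y"
proof -
  define P where "P = (\<lambda>U. \<exists>\<F>\<subseteq>\<B>. U = A - \<Inter>\<F>)"
  have "istopology P"
    unfolding istopology_def
  proof (intro conjI allI impI)
    fix U V assume "P U" "P V"
    then obtain \<F> \<G> where FG: "\<F> \<subseteq> \<B>" "U = A - \<Inter>\<F>" "\<G> \<subseteq> \<B>" "V = A - \<Inter>\<G>"
      unfolding P_def by blast
    let ?H = "{S \<union> T | S T. S \<in> \<F> \<and> T \<in> \<G>}"
    have "?H \<subseteq> \<B>" using FG un by blast
    moreover have "U \<inter> V = A - \<Inter>?H"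
      unfolding FG by auto
    ultimately show "P (U \<inter> V)" unfolding P_def by blast
  next
    fix \<K> assume "\<forall>K\<in>\<K>. P K"
    then obtain F where F: "\<And>K. K \<in> \<K> \<Longrightarrow> F K \<subseteq> \<B> \<and> K = A - \<Inter>(F K)"
      unfolding P_def by metis
    have "K = A - \<Inter>(F K)" if "K \<in> \<K>" for K
      using F that by blast
    then have "(\<lambda>K. A - \<Inter>(F K)) ` \<K> = id ` \<K>"
      by (intro image_cong) auto
    then have "\<Union>\<K> = (\<Union>K\<in>\<K>. A - \<Inter>(F K))" by simp
    also have "\<dots> = A - \<Inter>(\<Union>K\<in>\<K>. F K)" by blast
    finally have "\<Union>\<K> = A - \<Inter>(\<Union>K\<in>\<K>. F K)" .
    moreover have "(\<Union>K\<in>\<K>. F K) \<subseteq> \<B>"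
      using F by (intro UN_least) blast
    ultimately show "P (\<Union>\<K>)" unfolding P_def by blast
  qed
  then have op: "openin (topology P) = P" by (rule topology_inverse')
  have "P A" unfolding P_def using empty by (intro exI[of _ "{{}}"]) auto
  moreover have "U \<subseteq> A" if "P U" for U using that unfolding P_def by blast
  ultimately have top: "topspace (topology P) = A"
    unfolding topspace_def op by blast
  have "closed_base_of \<B> (topology P)"
    unfolding closed_base_of_def closedin_def top op
  proof (intro conjI ballI allI impI)
    fix S assume "S \<in> \<B>"
    then show "S \<subseteq> A" "P (A - S)"
      using sub unfolding P_def by (auto intro!: exI[of _ "{S}"])
  next
    fix S assume S: "S \<subseteq> A \<and> P (A - S)"
    then obtain \<F> where "\<F> \<subseteq> \<B>" "A - S = A - \<Inter>\<F>" unfolding P_def by blast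
    then show "\<exists>\<F>\<subseteq>\<B>. S = A \<inter> \<Inter>\<F>" using S by blast
  qed
  with top show ?thesis by blast
qed

lemma baire_one_topology:
  "topspace (baire_one_topology X) = topspace X \<and>
   closed_base_of {zero_set X f | f. f \<in> baire_one_functions X} (baire_one_topology X)"
proof -
  let ?B = "{zero_set X f | f. f \<in> baire_one_functions X}"
  have "\<exists>Y. topspace Y = topspace X \<and> closed_base_of ?B Y"
  proof (rule closed_base_of_exists)
    show "S \<subseteq> topspace X" if "S \<in> ?B" for S
      using that by (auto simp: zero_set_def)
    have "(\<lambda>_. 1) \<in> baire_one_functions X"
      unfolding baire_one_functions_def real_continuous_functions_def
      by (auto intro!: exI[of _ "\<lambda>_ _. 1"])
    moreover have "zero_set X (\<lambda>_. 1) = {}" by (simp add: zero_set_def)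
    ultimately show "{} \<in> ?B" by blast
    show "S \<union> T \<in> ?B" if ST: "S \<in> ?B" "T \<in> ?B" for S T
    proof -
      obtain f g where fg: "f \<in> baire_one_functions X" "g \<in> baire_one_functions X"
        and "S = zero_set X f" "T = zero_set X g" using ST by blast
      moreover have "(\<lambda>x. f x * g x) \<in> baire_one_functions X"
      proof -
        obtain u v where
          "\<And>n. continuous_map X euclideanreal (u n)" "\<And>n. continuous_map X euclideanreal (v n)"
          "\<And>x. x \<in> topspace X \<Longrightarrow> (\<lambda>n. u n x) \<longlonglongrightarrow> f x"
          "\<And>x. x \<in> topspace X \<Longrightarrow> (\<lambda>n. v n x) \<longlonglongrightarrow> g x"
          using fg unfolding baire_one_functions_def real_continuous_functions_def by blast
        then show ?thesis
          unfolding baire_one_functions_def real_continuous_functions_def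
          by (auto intro!: exI[of _ "\<lambda>n x. u n x * v n x"] continuous_map_real_mult tendsto_mult)
      qed
      moreover have "zero_set X (\<lambda>x. f x * g x) = zero_set X f \<union> zero_set X g"
        by (auto simp: zero_set_def)
      ultimately show ?thesis by blast
    qed
  qed
  then have "\<exists>!Y. topspace Y = topspace X \<and> closed_base_of ?B Y"
    using closed_base_of_unique[where \<B> = ?B] by (intro ex_ex1I) auto
  then show ?thesis
    unfolding baire_one_topology_def by (rule theI')
qed

end

theory Submission
  imports Defs
begin

text \<open>
  Two facts carry the equivalence.

  The sublevel and superlevel sets of a Baire one function are themselves zero sets of Baire one
  functions, because \<open>f x \<le> a\<close> holds exactly when the truncation \<open>max (f x - a) 0\<close> vanishes.  If the
  two topologies agree, these level sets are closed in \<open>\<tau>\<close>, and a real function whose sublevel and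
  superlevel sets are all closed is continuous.

  Conversely, a \<open>T\<^sub>4\<close> space is completely regular by Urysohn's lemma, so the zero sets of continuous
  functions form a base for the closed sets of \<open>\<tau>\<close>.  If every Baire one function is continuous,
  then this base is the one defining \<open>\<sigma>\<close>, and a topology is determined by a closed base.
\<close>

lemma real_continuous_subset_baire_one:
  "real_continuous_functions X \<subseteq> baire_one_functions X"
  unfolding baire_one_functions_def by (auto intro!: exI[of _ "\<lambda>_. f" for f])

text \<open>Postcomposition with a continuous function acts termwise on an approximating sequence; it is
  needed for the truncations that turn level sets into zero sets.\<close>

lemma baire_one_compose_continuous:
  assumes "f \<in> baire_one_functions X" and h: "continuous_on UNIV h"
  shows "(\<lambda>x. h (f x)) \<in> baire_one_functions X"
proof -
  obtain g where g: "\<And>n. continuous_map X euclideanreal (g n)"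
    and lim: "\<And>x. x \<in> topspace X \<Longrightarrow> (\<lambda>n. g n x) \<longlonglongrightarrow> f x"
    using assms(1) unfolding baire_one_functions_def real_continuous_functions_def by blast
  have "continuous_map X euclideanreal (\<lambda>x. h (g n x))" for n
    using continuous_map_compose[OF g, of euclideanreal h n] h by (simp add: o_def)
  moreover have "(\<lambda>n. h (g n x)) \<longlonglongrightarrow> h (f x)" if "x \<in> topspace X" for x
    using continuous_on_tendsto_compose[OF h lim[OF that]] by simp
  ultimately show ?thesis
    unfolding baire_one_functions_def real_continuous_functions_def
    by (auto intro!: exI[of _ "\<lambda>n x. h (g n x)"])
qed

lemma continuous_if_baire_one_zero_sets_closed:
  assumes closed: "\<And>g. g \<in> baire_one_functions X \<Longrightarrow> closedin X (zero_set X g)"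
    and f: "f \<in> baire_one_functions X"
  shows "continuous_map X euclideanreal f"
  unfolding continuous_map_upper_lower_semicontinuous_le
proof (intro conjI allI)
  fix a
  have "{x \<in> topspace X. f x \<ge> a} = zero_set X (\<lambda>x. max (a - f x) 0)"
    by (auto simp: zero_set_def max_def)
  moreover have "(\<lambda>x. max (a - f x) 0) \<in> baire_one_functions X"
    by (rule baire_one_compose_continuous[OF f]) (intro continuous_intros)
  ultimately show "closedin X {x \<in> topspace X. f x \<ge> a}"
    using closed by simp
  have "{x \<in> topspace X. f x \<le> a} = zero_set X (\<lambda>x. max (f x - a) 0)"
    by (auto simp: zero_set_def max_def)
  moreover have "(\<lambda>x. max (f x - a) 0) \<in> baire_one_functions X"
    by (rule baire_one_compose_continuous[OF f]) (intro continuous_intros)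
  ultimately show "closedin X {x \<in> topspace X. f x \<le> a}"
    using closed by simp
qed

text \<open>A closed set is the intersection of all zero sets containing it: each point outside is missed
  by the zero set of a function separating the point from the set.\<close>

lemma closed_base_of_continuous_zero_sets:
  assumes "completely_regular_space X"
  shows "closed_base_of {zero_set X f | f. f \<in> real_continuous_functions X} X"
  unfolding closed_base_of_def
proof (intro conjI ballI allI impI)
  fix S assume "S \<in> {zero_set X f | f. f \<in> real_continuous_functions X}"
  then obtain f where "continuous_map X euclideanreal f" "S = {x \<in> topspace X. f x \<in> {0}}"
    by (auto simp: real_continuous_functions_def zero_set_def)
  then show "closedin X S"
    using closedin_continuous_map_preimage[of X euclideanreal f "{0}"] by simp
next
  fix S assume S: "closedin X S"
  let ?F = "{zero_set X f | f. f \<in> real_continuous_functions X \<and> S \<subseteq> zero_set X f}"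
  have "x \<in> S" if x: "x \<in> topspace X" "x \<in> \<Inter>?F" for x
  proof (rule ccontr)
    assume "x \<notin> S"
    then obtain f where f: "continuous_map X euclideanreal f" "f x = 0" "f ` S \<subseteq> {1}"
      using assms S x(1) unfolding completely_regular_space_alt by blast
    (* Complete regularity gives the value 1 on S and 0 at x, so the values must be swapped. *)
    have "(\<lambda>y. 1 - f y) \<in> real_continuous_functions X"
      using f(1) by (auto simp: real_continuous_functions_def intro!: continuous_intros)
    moreover have "S \<subseteq> zero_set X (\<lambda>y. 1 - f y)"
      using closedin_subset[OF S] f(3) by (auto simp: zero_set_def)
    ultimately have "x \<in> zero_set X (\<lambda>y. 1 - f y)"
      using x(2) by blast
    then show False
      using f(2) by (simp add: zero_set_def)
  qed
  then have "S = topspace X \<inter> \<Inter>?F"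
    using closedin_subset[OF S] by blast
  then show "\<exists>\<F>\<subseteq>{zero_set X f | f. f \<in> real_continuous_functions X}. S = topspace X \<inter> \<Inter>\<F>"
    by (intro exI[of _ ?F]) blast
qed

theorem theorem4p15:
  fixes \<tau> :: "'a topology"
  assumes "t4_space \<tau>"
  shows "baire_one_topology \<tau> = \<tau> \<longleftrightarrow> baire_one_functions \<tau> = real_continuous_functions \<tau>"
proof
  assume "baire_one_topology \<tau> = \<tau>"
  then have "closed_base_of {zero_set \<tau> f | f. f \<in> baire_one_functions \<tau>} \<tau>"
    using baire_one_topology[of \<tau>] by simp
  then have "closedin \<tau> (zero_set \<tau> g)" if "g \<in> baire_one_functions \<tau>" for g
    using that unfolding closed_base_of_def by blast
  then have "baire_one_functions \<tau> \<subseteq> real_continuous_functions \<tau>"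
    using continuous_if_baire_one_zero_sets_closed
    unfolding real_continuous_functions_def by blast
  then show "baire_one_functions \<tau> = real_continuous_functions \<tau>"
    using real_continuous_subset_baire_one by blast
next
  assume eq: "baire_one_functions \<tau> = real_continuous_functions \<tau>"
  have "completely_regular_space \<tau>"
    using assms normal_imp_completely_regular_space_A unfolding t4_space_def by blast
  then have "closed_base_of {zero_set \<tau> f | f. f \<in> baire_one_functions \<tau>} \<tau>"
    unfolding eq by (rule closed_base_of_continuous_zero_sets)
  then show "baire_one_topology \<tau> = \<tau>"
    using closed_base_of_unique baire_one_topology[of \<tau>] by blast
qed

end
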